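(* Let $\lambda$ be a nonzero real (or complex) number and let $k\in\mathbb{Z}$. For every integer $n\ge 1$, $$\beta_{n,\lambda}^{(k)}(1)-\beta_{n,\lambda}^{(k)}=(-1)^{n}\sum_{m=1}^{n}\frac{(1)_{m,1/\lambda}}{m^{k-1}}\lambda^{m-1}S_{2,\lambda}(n,m).$$
   Context: All generating functions are formal power series. For nonzero $\lambda$ and any $x$, the degenerate exponential is $e_\lambda^x(t)=(1+\lambda t)^{x/\lambda}=\sum_{n\ge0}\binom{x/\lambda}{n}\lambda^n t^n$ and $e_\lambda(t)=e_\lambda^1(t)$. For nonzero $\mu$, put $(1)_{0,\mu}=1$ and $(1)_{n,\mu}=(1-\mu)(1-2\mu)\cdots(1-(n-1)\mu)$ for $n\ge1$ (so $(1)_{1,\mu}=1$). The degenerate Stirling numbers of the second kind $S_{2,\lambda}(n,m)$ are defined, for each $m\ge0$, by $\frac{1}{m!}(e_{\lambda}(t)-1)^{m}=\sum_{n=m}^{\infty}S_{2,\lambda}(n,m)\frac{t^{n}}{n!}$. For $k\in\mathbb{Z}$ the degenerate polylogarithm function is $l_{k,\lambda}(x)=\sum_{n=1}^{\infty}\frac{(-\lambda)^{n-1}(1)_{n,1/\lambda}}{(n-1)!\,n^{k}}x^{n}$. The degenerate poly-Bernoulli polynomials $\beta_{n,\lambda}^{(k)}(x)$ are defined by $$\frac{l_{k,\lambda}(1-e_{\lambda}(-t))}{1-e_{\lambda}(-t)}\,e_\lambda^x(-t)=\sum_{n=0}^{\infty}\beta_{n,\lambda}^{(k)}(x)\frac{t^{n}}{n!},$$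 where the first factor is obtained by substituting $y=1-e_\lambda(-t)$ (which has zero constant term) into the power series $l_{k,\lambda}(y)/y$. The degenerate poly-Bernoulli numbers are $\beta_{n,\lambda}^{(k)}=\beta_{n,\lambda}^{(k)}(0)$. *)

theory Defs
  imports Complex_Main "HOL-Computational_Algebra.Formal_Power_Series"
begin

text \<open>The series \<open>e\<^sub>\<lambda>\<^sup>x(t) = (1 + \<lambda> t)\<^bsup>x/\<lambda>\<^esup>\<close>; meaningful for \<open>lam = \<lambda> \<noteq> 0\<close>.\<close>

definition degen_exp :: "'a::field_char_0 \<Rightarrow> 'a \<Rightarrow> 'a fps" where
  "degen_exp lam x = Abs_fps (\<lambda>n. ((x / lam) gchoose n) * lam ^ n)"

text \<open>The degenerate falling factorial \<open>(1)\<^bsub>n,\<mu>\<^esub>\<close>.\<close>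

definition degen_one :: "nat \<Rightarrow> 'a::field_char_0 \<Rightarrow> 'a" where
  "degen_one n \<mu> = (\<Prod>i=1..<n. 1 - of_nat i * \<mu>)"

text \<open>\<open>S\<^bsub>2,\<lambda>\<^esub>(n,m)\<close>. Since \<open>e\<^sub>\<lambda>(t) - 1\<close> has zero constant term, this is
  \<open>0\<close> for \<open>n < m\<close>, so that the generating function may be summed from \<open>n = m\<close>.\<close>

definition degen_stirling2 :: "'a::field_char_0 \<Rightarrow> nat \<Rightarrow> nat \<Rightarrow> 'a" where
  "degen_stirling2 lam n m =
     fact n * fps_nth (fps_const (1 / fact m) * (degen_exp lam 1 - 1) ^ m) n"

definition degen_polylog :: "int \<Rightarrow> 'a::field_char_0 \<Rightarrow> 'a fps" where
  "degen_polylog k lam = Abs_fps (\<lambda>n. if n = 0 then 0 else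
     (- lam) ^ (n - 1) * degen_one n (1 / lam) / (fact (n - 1) * of_nat n powi k))"

text \<open>\<open>oo\<close> is composition of power series, so \<open>degen_exp lam x oo (- fps_X)\<close>
  is \<open>e\<^sub>\<lambda>\<^sup>x(-t)\<close>. The division by \<open>fps_X\<close> is exact, as \<open>degen_polylog k lam\<close>
  has zero constant term.\<close>

definition degen_poly_bernoulli_gf :: "int \<Rightarrow> 'a::field_char_0 \<Rightarrow> 'a \<Rightarrow> 'a fps" where
  "degen_poly_bernoulli_gf k lam x =
     ((degen_polylog k lam / fps_X) oo (1 - (degen_exp lam 1 oo (- fps_X))))
       * (degen_exp lam x oo (- fps_X))"

definition degen_poly_bernoulli :: "int \<Rightarrow> nat \<Rightarrow> 'a::field_char_0 \<Rightarrow> 'a \<Rightarrow> 'a" where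
  "degen_poly_bernoulli k n lam x = fact n * fps_nth (degen_poly_bernoulli_gf k lam x) n"

definition degen_poly_bernoulli_number :: "int \<Rightarrow> nat \<Rightarrow> 'a::field_char_0 \<Rightarrow> 'a" where
  "degen_poly_bernoulli_number k n lam = degen_poly_bernoulli k n lam 0"

lemma degen_stirling2_gf:
  "fps_const (1 / fact m) * (degen_exp lam 1 - 1) ^ m
     = Abs_fps (\<lambda>n. degen_stirling2 lam n m / fact n)"
  by (rule fps_ext) (simp add: degen_stirling2_def)

lemma degen_stirling2_eq_0: "n < m \<Longrightarrow> degen_stirling2 lam n m = 0"
  by (simp add: degen_stirling2_def degen_exp_def startsby_zero_power_prefix)

lemma degen_poly_bernoulli_gf_eq:
  "degen_poly_bernoulli_gf k lam x = Abs_fps (\<lambda>n. degen_poly_bernoulli k n lam x / fact n)"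
  by (rule fps_ext) (simp add: degen_poly_bernoulli_def)

lemma degen_polylog_divide_X: "degen_polylog k lam / fps_X * fps_X = degen_polylog k lam"
  by (rule fps_ext) (simp add: degen_polylog_def)

lemma degen_poly_bernoulli_inner_nth_0:
  "fps_nth (1 - (degen_exp lam 1 oo (- fps_X))) 0 = 0"
  by (simp add: degen_exp_def)

end

theory Submission
  imports Defs
begin

text \<open>Put \<open>y = 1 - e\<^sub>\<lambda>(-t)\<close>. Since \<open>e\<^sub>\<lambda>\<^sup>1(-t) - e\<^sub>\<lambda>\<^sup>0(-t) = -y\<close>, the difference of the two generating
  functions is \<open>-l\<^bsub>k,\<lambda>\<^esub>(y)\<close>. The \<open>n\<close>-th coefficient is then read off from
  \<open>y\<^sup>m = (-1)\<^sup>m (e\<^sub>\<lambda>(-t) - 1)\<^sup>m\<close>, the generating function of the numbers \<open>S\<^bsub>2,\<lambda>\<^esub>(n,m)\<close> at \<open>-t\<close>.\<close>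

lemma degen_exp_0 [simp]: "degen_exp lam 0 = 1"
  by (rule fps_ext) (simp add: degen_exp_def gbinomial_0_left)

lemma fps_nth_compose_minus_X:
  fixes f :: "'a::comm_ring_1 fps"
  shows "fps_nth (f oo (- fps_X)) n = (- 1) ^ n * fps_nth f n"
  using fps_compose_linear[of f "- 1"] by (simp flip: fps_const_neg)

lemma degen_poly_bernoulli_gf_diff:
  "degen_poly_bernoulli_gf k lam 1 - degen_poly_bernoulli_gf k lam 0
     = - (degen_polylog k lam oo (1 - (degen_exp lam 1 oo (- fps_X))))"
proof -
  define y where "y = 1 - (degen_exp lam 1 oo (- fps_X))"
  have "fps_nth y 0 = 0"
    unfolding y_def by (rule degen_poly_bernoulli_inner_nth_0)
  \<comment> \<open>Substitute \<open>y\<close> into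
    \<open>degen_polylog k lam / fps_X * fps_X = degen_polylog k lam\<close>; the zero constant term
    of \<open>y\<close> makes composition multiplicative and turns \<open>fps_X\<close> into
    \<open>y\<close>.\<close>
  then have "(degen_polylog k lam / fps_X oo y) * y = degen_polylog k lam oo y"
    by (metis degen_polylog_divide_X fps_compose_mult_distrib fps_X_fps_compose_startby0)
  then show ?thesis
    unfolding degen_poly_bernoulli_gf_def y_def by (simp add: algebra_simps)
qed

lemma fps_nth_degen_exp_minus_1_power:
  "fps_nth ((degen_exp lam 1 - 1) ^ m) n = fact m * degen_stirling2 lam n m / fact n"
  by (simp add: degen_stirling2_def)

text \<open>Two separate signs: \<open>(- 1) ^ m\<close> comes from reversing the difference inside
  the power, \<open>(- 1) ^ n\<close> from substituting -t for t.\<close>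

lemma fps_nth_one_minus_degen_exp_power:
  "fps_nth ((1 - (degen_exp lam 1 oo (- fps_X))) ^ m) n
     = (- 1) ^ m * (- 1) ^ n * (fact m * degen_stirling2 lam n m / fact n)"
proof -
  have "1 - (degen_exp lam 1 oo (- fps_X)) = - ((degen_exp lam 1 - 1) oo (- fps_X))"
    by (simp add: fps_compose_sub_distrib)
  then have "(1 - (degen_exp lam 1 oo (- fps_X))) ^ m
      = fps_const ((- 1) ^ m) * ((degen_exp lam 1 - 1) ^ m oo (- fps_X))"
    by (simp add: power_minus[of "degen_exp lam 1 - 1 oo - fps_X"] fps_compose_power
        flip: fps_const_power fps_const_neg)
  then show ?thesis
    by (simp add: fps_nth_compose_minus_X fps_nth_degen_exp_minus_1_power)
qed

text \<open>The quotient \<open>fact m / fact (m - 1)\<close> is m, which lowers the exponent k to k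
  - 1; the signs \<open>(- 1) ^ (m - 1)\<close> and \<open>(- 1) ^ m\<close> leave a single
  minus.\<close>

lemma fps_nth_degen_polylog_times_fact:
  assumes "m \<ge> 1"
  shows "fps_nth (degen_polylog k lam) m * ((- 1) ^ m * fact m)
    = - (degen_one m (1 / lam) / (of_nat m powi (k - 1)) * lam ^ (m - 1))"
proof -
  obtain j where m: "m = Suc j"
    using assms by (cases m) auto
  have "(- lam) ^ j = (- 1) ^ j * lam ^ j"
    by (rule power_minus)
  moreover have "(- 1) ^ j * (- 1) ^ j = (1::'a)"
    by (simp flip: power_mult_distrib)
  moreover have "(of_nat (Suc j) :: 'a) powi k = of_nat (Suc j) powi (k - 1) * of_nat (Suc j)"
    using power_int_add_1[of "of_nat (Suc j) :: 'a" "k - 1"] by (simp del: of_nat_Suc)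
  ultimately show ?thesis
    by (simp add: m degen_polylog_def divide_simps del: of_nat_Suc)
qed

theorem theorem7:
  fixes lam :: "'a::real_normed_field" and k :: int and n :: nat
  assumes "lam \<noteq> 0" and "n \<ge> 1"
  shows "degen_poly_bernoulli k n lam 1 - degen_poly_bernoulli_number k n lam
    = (- 1) ^ n * (\<Sum>m=1..n. degen_one m (1 / lam) / (of_nat m powi (k - 1))
                              * lam ^ (m - 1) * degen_stirling2 lam n m)"
proof -
  define y where "y = 1 - (degen_exp lam 1 oo (- fps_X))"
  let ?c = "\<lambda>m. degen_one m (1 / lam) / (of_nat m powi (k - 1)) * lam ^ (m - 1)"
  have "degen_poly_bernoulli k n lam 1 - degen_poly_bernoulli_number k n lam
      = fact n * fps_nth (degen_poly_bernoulli_gf k lam 1 - degen_poly_bernoulli_gf k lam 0) n"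
    by (simp add: degen_poly_bernoulli_number_def degen_poly_bernoulli_def right_diff_distrib)
  also have "\<dots> = - fact n * (\<Sum>m=0..n. fps_nth (degen_polylog k lam) m * fps_nth (y ^ m) n)"
    by (simp add: degen_poly_bernoulli_gf_diff fps_compose_nth y_def)
  \<comment> \<open>The term m = 0 vanishes, since the polylogarithm has zero constant term.\<close>
  also have "(\<Sum>m=0..n. fps_nth (degen_polylog k lam) m * fps_nth (y ^ m) n)
      = (\<Sum>m=1..n. fps_nth (degen_polylog k lam) m * fps_nth (y ^ m) n)"
    by (simp add: sum.atLeast_Suc_atMost degen_polylog_def)
  \<comment> \<open>The factor \<open>(- 1) ^ m * fact m\<close> of the coefficient of
    \<open>y ^ m\<close> is moved to the polylogarithm coefficient, where it cancels.\<close>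
  also have "\<dots> = (\<Sum>m=1..n. (fps_nth (degen_polylog k lam) m * ((- 1) ^ m * fact m))
      * ((- 1) ^ n * degen_stirling2 lam n m / fact n))"
    by (simp add: y_def fps_nth_one_minus_degen_exp_power mult_ac)
  also have "\<dots> = (\<Sum>m=1..n. - ?c m * ((- 1) ^ n * degen_stirling2 lam n m / fact n))"
    by (intro sum.cong refl) (simp only: fps_nth_degen_polylog_times_fact atLeastAtMost_iff)
  also have "- fact n * \<dots> = (- 1) ^ n * (\<Sum>m=1..n. ?c m * degen_stirling2 lam n m)"
    unfolding sum_distrib_left by (intro sum.cong refl) simp
  finally show ?thesis .
qed

end
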